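(* Let $D$ be a divisor on a loopless graph $G$, let $k$ be a positive integer, and let $G^k$ be the graph obtained from $G$ by subdividing each edge of $G$ exactly $k$ times (i.e. replacing each edge by a path with $k$ inner vertices). Then the ranks of $D$ in $G$ and in $G^k$ are the same: $r_G(D)=r_{G^k}(D)$, where on the right $D$ is regarded as a divisor on $G^k$ via $V(G)\subseteq V(G^k)$ (value $0$ at the new vertices).
   Context: A graph $G$ is a finite connected multigraph (parallel edges allowed); it is loopless if it has no loops. A divisor on $G$ is an element $D=\sum_{v\in V(G)}D(v)(v)$, $D(v)\in\mathbb Z$, of the free abelian group $\mathrm{Div}(G)$ on $V(G)$; it is effective ($D\ge 0$) if $D(v)\ge 0$ for all $v$; its degree is $\deg(D)=\sum_v D(v)$. For $f:V(G)\to\mathbb Z$ let $\mathrm{div}(f)=\sum_{v\in V(G)}\sum_{e=vw\in E(G)}(f(v)-f(w))(v)$. Divisors $D,D'$ on $G$ are equivalent, $D\sim D'$, if $D-D'=\mathrm{div}(f)$ for some $f:V(G)\to\mathbb Z$. Put $|D|=\{E\in \mathrm{Div}(G): E\ge 0,\ E\sim D\}$. The rank of $D$ on $G$ is $$r_G(D)=\min\{\deg(E): E\in\mathrm{Div}(G),\ E\ge 0,\ |D-E|=\emptyset\}-1 .$$ *)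

theory Defs
  imports Main "HOL-Library.Uprod"
begin

record ('v, 'e) multigraph =
  verts :: "'v set"
  edges :: "'e set"
  ends :: "'e \<Rightarrow> 'v uprod"

text \<open>Parallel edges are distinct elements of \<^term>\<open>edges G\<close> with the same ends; a loop at \<open>v\<close> has
  ends \<^term>\<open>Upair v v\<close>.\<close>

definition edge_rel :: "('v, 'e) multigraph \<Rightarrow> ('v \<times> 'v) set" where
  "edge_rel G = {(u, v). \<exists>e\<in>edges G. ends G e = Upair u v}"

definition finite_connected :: "('v, 'e) multigraph \<Rightarrow> bool" where
  "finite_connected G \<longleftrightarrow>
     finite (verts G) \<and> finite (edges G) \<and>
     (\<forall>e\<in>edges G. set_uprod (ends G e) \<subseteq> verts G) \<and>
     verts G \<noteq> {} \<and>
     (\<forall>u\<in>verts G. \<forall>v\<in>verts G. (u, v) \<in> (edge_rel G)\<^sup>*)"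

definition loopless :: "('v, 'e) multigraph \<Rightarrow> bool" where
  "loopless G \<longleftrightarrow> (\<forall>e\<in>edges G. proper_uprod (ends G e))"

text \<open>The free abelian group on the (finite) set \<^term>\<open>verts G\<close>: integer functions vanishing
  outside it, added pointwise.\<close>

definition Div :: "('v, 'e) multigraph \<Rightarrow> ('v \<Rightarrow> int) set" where
  "Div G = {D. \<forall>v. v \<notin> verts G \<longrightarrow> D v = 0}"

definition effective :: "('v, 'e) multigraph \<Rightarrow> ('v \<Rightarrow> int) \<Rightarrow> bool" where
  "effective G D \<longleftrightarrow> (\<forall>v\<in>verts G. 0 \<le> D v)"

definition deg :: "('v, 'e) multigraph \<Rightarrow> ('v \<Rightarrow> int) \<Rightarrow> int" where
  "deg G D = (\<Sum>v\<in>verts G. D v)"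

text \<open>Only the values of \<open>f\<close> on \<^term>\<open>verts G\<close> matter: the other end of an edge of a
  finite connected graph is again a vertex of it, and at \<open>v\<close> outside the graph the sum is empty.\<close>

definition divf :: "('v, 'e) multigraph \<Rightarrow> ('v \<Rightarrow> int) \<Rightarrow> 'v \<Rightarrow> int" where
  "divf G f v = (\<Sum>(e, w) | e \<in> edges G \<and> ends G e = Upair v w. f v - f w)"

definition equivalent :: "('v, 'e) multigraph \<Rightarrow> ('v \<Rightarrow> int) \<Rightarrow> ('v \<Rightarrow> int) \<Rightarrow> bool" where
  "equivalent G D D' \<longleftrightarrow> (\<exists>f. (\<lambda>v. D v - D' v) = divf G f)"

definition linear_system :: "('v, 'e) multigraph \<Rightarrow> ('v \<Rightarrow> int) \<Rightarrow> ('v \<Rightarrow> int) set" where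
  "linear_system G D = {E \<in> Div G. effective G E \<and> equivalent G E D}"

text \<open>The set of degrees is infinite, which rules out \<^term>\<open>Min\<close>. It is bounded below by \<open>0\<close>,
  and it is nonempty since \<^term>\<open>linear_system G D\<close> is empty for \<open>D\<close> of negative degree, so the
  least element exists.\<close>

definition rank :: "('v, 'e) multigraph \<Rightarrow> ('v \<Rightarrow> int) \<Rightarrow> int" where
  "rank G D =
     (LEAST d. d \<in> {deg G E | E. E \<in> Div G \<and> effective G E \<and>
                                linear_system G (\<lambda>v. D v - E v) = {}}) - 1"

definition orientation :: "('v, 'e) multigraph \<Rightarrow> ('e \<Rightarrow> 'v) \<Rightarrow> ('e \<Rightarrow> 'v) \<Rightarrow> bool" where
  "orientation G s t \<longleftrightarrow> (\<forall>e\<in>edges G. ends G e = Upair (s e) (t e))"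

text \<open>The edge \<open>e\<close> is replaced by the path with vertices \<open>Inl (s e), Inr (e, 1), \<dots>, Inr (e, k),
  Inl (t e)\<close>; \<open>path_vertex k s t e i\<close> is its vertex number \<open>i\<close>, for \<open>0 \<le> i \<le> k + 1\<close>. The
  orientation only fixes the direction in which the inner vertices are numbered.\<close>

definition path_vertex ::
    "nat \<Rightarrow> ('e \<Rightarrow> 'v) \<Rightarrow> ('e \<Rightarrow> 'v) \<Rightarrow> 'e \<Rightarrow> nat \<Rightarrow> 'v + 'e \<times> nat" where
  "path_vertex k s t e i =
     (if i = 0 then Inl (s e) else if i = Suc k then Inl (t e) else Inr (e, i))"

definition subdivide ::
    "nat \<Rightarrow> ('e \<Rightarrow> 'v) \<Rightarrow> ('e \<Rightarrow> 'v) \<Rightarrow> ('v, 'e) multigraph \<Rightarrow>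
       ('v + 'e \<times> nat, 'e \<times> nat) multigraph" where
  "subdivide k s t G =
     \<lparr>verts = Inl ` verts G \<union> Inr ` (edges G \<times> {1..k}),
      edges = edges G \<times> {0..k},
      ends = (\<lambda>(e, i). Upair (path_vertex k s t e i) (path_vertex k s t e (Suc i)))\<rparr>"

definition extend_divisor :: "('v \<Rightarrow> int) \<Rightarrow> 'v + 'e \<times> nat \<Rightarrow> int" where
  "extend_divisor D = case_sum D (\<lambda>_. 0)"

end

theory Submission
  imports Defs
begin

text \<open>Linear interpolation along the subdivided edges, and rounding down in the other direction, show
  that a divisor supported on the old vertices has an effective representative in \<open>G\<close> iff it has
  one in \<open>G\<^sup>k\<close>. It remains to see that the old vertices determine the rank in \<open>G\<^sup>k\<close>: if for a
  divisor \<open>D\<close> on \<open>G\<^sup>k\<close> every \<open>|D - v|\<close> with \<open>v\<close> old is nonempty, then so is \<open>|D - x|\<close> for each inner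
  vertex \<open>x\<close>. Otherwise the \<open>x\<close>-reduced divisor \<open>D' \<sim> D\<close> has no chip at \<open>x\<close>. It cannot have chips on
  both sides of \<open>x\<close> on its path, ends included, since the ends are distinct and the complement of the
  segment between the chips could fire. So Dhar's fire from \<open>x\<close> reaches an end \<open>u\<close> with
  \<open>D' u = 0\<close>, hence \<open>D'\<close> is also \<open>u\<close>-reduced and \<open>|D - u|\<close> is empty.\<close>

section \<open>The Laplacian and linear systems of a graph with oriented edges\<close>

locale oriented_graph =
  fixes G :: "('v, 'e) multigraph" and s t :: "'e \<Rightarrow> 'v"
  assumes finite_connected: "finite_connected G"
    and orientation: "orientation G s t"
begin

lemma finite_verts: "finite (verts G)"
  and finite_edges: "finite (edges G)"
  and verts_nonempty: "verts G \<noteq> {}"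
  and connected: "u \<in> verts G \<Longrightarrow> v \<in> verts G \<Longrightarrow> (u, v) \<in> (edge_rel G)\<^sup>*"
  using finite_connected by (auto simp: finite_connected_def)

lemma ends_eq: "e \<in> edges G \<Longrightarrow> ends G e = Upair (s e) (t e)"
  using orientation by (simp add: orientation_def)

lemma source_in_verts: "e \<in> edges G \<Longrightarrow> s e \<in> verts G"
  and target_in_verts: "e \<in> edges G \<Longrightarrow> t e \<in> verts G"
  using finite_connected ends_eq by (force simp: finite_connected_def)+

lemma edge_rel_iff:
  "(u, v) \<in> edge_rel G \<longleftrightarrow> (\<exists>e\<in>edges G. s e = u \<and> t e = v \<or> s e = v \<and> t e = u)"
  using ends_eq by (auto simp: edge_rel_def Upair_inject)

text \<open>The index set \<open>edges G\<close> no longer depends on \<open>v\<close>, so such sums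
  can be compared edge by edge and swapped with sums over vertices. A loop contributes 0 to either
  side.\<close>

lemma divf_eq_sum:
  "divf G f v = (\<Sum>e\<in>edges G. of_bool (s e = v) * (f (s e) - f (t e)) +
                               of_bool (t e = v) * (f (t e) - f (s e)))"
proof -
  let ?W = "\<lambda>e. {w. ends G e = Upair v w}"
  have W: "?W e = (if s e = v then {t e} else {}) \<union> (if t e = v then {s e} else {})"
    if "e \<in> edges G" for e
    using ends_eq[OF that] by (auto simp: Upair_inject)
  have "divf G f v = (\<Sum>(e, w)\<in>Sigma (edges G) ?W. f v - f w)"
    unfolding divf_def by (rule sum.cong) auto
  also have "\<dots> = (\<Sum>e\<in>edges G. \<Sum>w\<in>?W e. f v - f w)"
    by (rule sum.Sigma[symmetric]) (use finite_edges W in auto)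
  also have "\<dots> = (\<Sum>e\<in>edges G. of_bool (s e = v) * (f (s e) - f (t e)) +
                                of_bool (t e = v) * (f (t e) - f (s e)))"
    by (rule sum.cong[OF refl], subst W) (auto simp: insert_is_Un[symmetric] sum.insert_if)
  finally show ?thesis .
qed

lemma divf_outside: "v \<notin> verts G \<Longrightarrow> divf G f v = 0"
  unfolding divf_eq_sum by (rule sum.neutral) (use source_in_verts target_in_verts in auto)

lemma divf_add: "divf G (\<lambda>v. f v + g v) v = divf G f v + divf G g v"
  unfolding divf_eq_sum sum.distrib[symmetric] by (rule sum.cong) (auto simp: algebra_simps)

lemma divf_uminus: "divf G (\<lambda>v. - f v) v = - divf G f v"
  unfolding divf_eq_sum sum_negf[symmetric] by (rule sum.cong) (auto simp: algebra_simps)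

text \<open>Summation by parts. The right-hand side is symmetric in \<open>h\<close> and
  \<open>f\<close>, so the Laplacian is self-adjoint; \<open>h = 1\<close> gives degree 0.\<close>

lemma green:
  "(\<Sum>v\<in>verts G. h v * divf G f v) = (\<Sum>e\<in>edges G. (h (s e) - h (t e)) * (f (s e) - f (t e)))"
proof -
  have "(\<Sum>v\<in>verts G. h v * divf G f v) =
      (\<Sum>v\<in>verts G. \<Sum>e\<in>edges G. (if s e = v then h v * (f (s e) - f (t e)) else 0) +
                                  (if t e = v then h v * (f (t e) - f (s e)) else 0))"
    unfolding divf_eq_sum sum_distrib_left
    by (intro sum.cong refl) (auto simp: algebra_simps)
  also have "\<dots> = (\<Sum>e\<in>edges G. h (s e) * (f (s e) - f (t e)) + h (t e) * (f (t e) - f (s e)))"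
    by (subst sum.swap, intro sum.cong refl)
      (simp add: sum.distrib finite_verts source_in_verts target_in_verts)
  finally show ?thesis by (simp add: algebra_simps)
qed

lemma deg_divf: "deg G (divf G f) = 0"
  using green[of "\<lambda>_. 1" f] by (simp add: deg_def)

lemma linear_system_nonempty_iff:
  assumes "D \<in> Div G"
  shows "linear_system G D \<noteq> {} \<longleftrightarrow> (\<exists>f. \<forall>v\<in>verts G. 0 \<le> D v + divf G f v)"
proof
  assume "linear_system G D \<noteq> {}"
  then obtain E f where "effective G E" "(\<lambda>v. E v - D v) = divf G f"
    by (auto simp: linear_system_def equivalent_def)
  moreover from this(2) have "E v = D v + divf G f v" for v
    by (metis add.commute diff_add_cancel)
  ultimately show "\<exists>f. \<forall>v\<in>verts G. 0 \<le> D v + divf G f v"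
    by (auto simp: effective_def)
next
  assume "\<exists>f. \<forall>v\<in>verts G. 0 \<le> D v + divf G f v"
  then obtain f where "\<forall>v\<in>verts G. 0 \<le> D v + divf G f v" ..
  then have "(\<lambda>v. D v + divf G f v) \<in> linear_system G D"
    using assms divf_outside
    by (auto simp: linear_system_def equivalent_def Div_def effective_def)
  then show "linear_system G D \<noteq> {}" by blast
qed

lemma deg_linear_system:
  assumes "E \<in> linear_system G D"
  shows "deg G D = deg G E"
proof -
  obtain f where "(\<lambda>v. E v - D v) = divf G f"
    using assms by (auto simp: linear_system_def equivalent_def)
  then have "deg G (\<lambda>v. E v - D v) = 0"
    by (simp add: deg_divf)
  then show ?thesis by (simp add: deg_def sum_subtractf)
qed

lemma deg_nonneg: "effective G E \<Longrightarrow> 0 \<le> deg G E"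
  by (auto simp: effective_def deg_def intro: sum_nonneg)

section \<open>Existence of reduced divisors\<close>

text \<open>Take minus a large power that grows as the distance to \<open>x\<close> shrinks: a
  neighbour of \<open>v\<close> closer to \<open>x\<close> then outweighs all other edges at
  \<open>v\<close>.\<close>

lemma superharmonic_exists:
  assumes x: "x \<in> verts G"
  shows "\<exists>h :: 'v \<Rightarrow> int. \<forall>v\<in>verts G - {x}. 0 < divf G h v"
proof -
  define d where "d v = (LEAST n. (x, v) \<in> edge_rel G ^^ n)" for v
  have d: "(x, v) \<in> edge_rel G ^^ d v" if "v \<in> verts G" for v
    using connected[OF x that] unfolding d_def rtrancl_power by (rule LeastI_ex)
  have d_le: "d v \<le> n" if "(x, v) \<in> edge_rel G ^^ n" for v n
    unfolding d_def using that by (rule Least_le)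
  have d_step: "d w \<le> Suc (d v)" if "(v, w) \<in> edge_rel G" "v \<in> verts G" for v w
    using d[OF that(2)] that(1) by (intro d_le) auto
  define R where "R = Max (d ` verts G)"
  have R: "d v \<le> R" if "v \<in> verts G" for v
    unfolding R_def using finite_verts that by simp
  define N :: int where "N = int (card (edges G)) + 2"
  have N: "1 \<le> N" by (simp add: N_def)
  \<comment> \<open>On \<open>verts G\<close> the exponent \<open>R - d v\<close> is not truncated,
    so one step towards \<open>x\<close> multiplies \<open>h\<close> by \<open>N\<close>.\<close>
  define h where "h v = - (N ^ (R - d v))" for v
  have "0 < divf G h v" if v: "v \<in> verts G" "v \<noteq> x" for v
  proof -
    let ?q = "N ^ (R - d v)"
    let ?g = "\<lambda>e. of_bool (s e = v) * (h (s e) - h (t e)) + of_bool (t e = v) * (h (t e) - h (s e))"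
    have q: "1 \<le> ?q" using N by simp
    have low: "- ?q \<le> h v - h w" for w
      using N by (simp add: h_def)
    have lowg: "- ?q \<le> ?g e" for e
      using low[of "t e"] low[of "s e"] q by auto
    obtain n where n: "d v = Suc n"
      using d[OF v(1)] v(2) by (cases "d v") auto
    then obtain u where u: "(x, u) \<in> edge_rel G ^^ n" "(u, v) \<in> edge_rel G"
      using d[OF v(1)] by auto
    obtain e where e: "e \<in> edges G" "s e = u \<and> t e = v \<or> s e = v \<and> t e = u"
      using u(2) by (auto simp: edge_rel_iff)
    then have "u \<in> verts G"
      using source_in_verts target_in_verts by blast
    then have du: "Suc (d u) = d v"
      using d_step[OF u(2)] d_le[OF u(1)] n by simp
    have "R - d u = Suc (R - d v)" using du R[OF v(1)] by simp
    then have "h v - h u = (N - 1) * ?q" by (simp add: h_def algebra_simps)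
    moreover have "u \<noteq> v" using du by auto
    ultimately have ge: "?g e = (N - 1) * ?q" using e(2) by auto
    \<comment> \<open>The other \<open>N - 3\<close> edges lose at most \<open>?q\<close> each,
      against the gain \<open>(N - 1) * ?q\<close> along \<open>e\<close>; this leaves at least
      \<open>2 * ?q\<close>.\<close>
    have "(\<Sum>e'\<in>edges G - {e}. - ?q) \<le> (\<Sum>e'\<in>edges G - {e}. ?g e')"
      by (rule sum_mono) (rule lowg)
    moreover have "(\<Sum>e'\<in>edges G - {e}. - ?q) = - (N - 3) * ?q"
    proof -
      have "card (edges G) > 0" using e(1) finite_edges card_gt_0_iff by blast
      then have c: "int (card (edges G - {e})) = N - 3"
        using e(1) by (simp add: N_def)
      show ?thesis unfolding sum_constant c by (simp add: algebra_simps)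
    qed
    moreover have "divf G h v = ?g e + (\<Sum>e'\<in>edges G - {e}. ?g e')"
      unfolding divf_eq_sum using e(1) finite_edges by (simp add: sum.remove)
    ultimately have "2 * ?q \<le> divf G h v"
      using ge by (simp add: algebra_simps)
    with q show ?thesis by linarith
  qed
  then show ?thesis by blast
qed

text \<open>Firing a set that avoids \<open>x\<close> strictly decreases the energy \<open>\<Sum>v. h v * D v\<close> of a function \<open>h\<close>
  that is strictly superharmonic off \<open>x\<close>, so an effective divisor of least energy is \<open>x\<close>-reduced.\<close>

lemma reduced_exists:
  assumes x: "x \<in> verts G" and D: "linear_system G D \<noteq> {}"
  shows "\<exists>D'\<in>linear_system G D. \<forall>S. S \<subseteq> verts G - {x} \<and> S \<noteq> {} \<longrightarrow>
           (\<exists>v\<in>verts G. D' v < divf G (\<lambda>v. of_bool (v \<in> S)) v)"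
proof -
  obtain h :: "'v \<Rightarrow> int" where h: "\<And>v. v \<in> verts G - {x} \<Longrightarrow> 0 < divf G h v"
    using superharmonic_exists[OF x] by blast
  \<comment> \<open>Shifting \<open>h\<close> by its minimum makes the energy of effective divisors
    nonnegative, so that a least one exists. The constant cancels in \<open>green\<close>, which
    sees only differences.\<close>
  define m where "m = Min (h ` verts G)"
  have m: "m \<le> h v" if "v \<in> verts G" for v
    unfolding m_def using finite_verts that by simp
  define energy where "energy E = (\<Sum>v\<in>verts G. (h v - m) * E v)" for E
  have nonneg: "0 \<le> energy E" if "E \<in> linear_system G D" for E
    using that m by (auto simp: energy_def linear_system_def effective_def intro!: sum_nonneg)
  obtain D' where D': "D' \<in> linear_system G D"
    and least: "\<And>E. E \<in> linear_system G D \<Longrightarrow> nat (energy D') \<le> nat (energy E)"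
    using D ex_has_least_nat[of "\<lambda>E. E \<in> linear_system G D" _ "\<lambda>E. nat (energy E)"] by blast
  have "\<exists>v\<in>verts G. D' v < divf G (\<lambda>v. of_bool (v \<in> S)) v"
    if S: "S \<subseteq> verts G - {x}" "S \<noteq> {}" for S
  proof (rule ccontr)
    let ?c = "\<lambda>v. of_bool (v \<in> S) :: int"
    assume "\<not> ?thesis"
    then have le: "divf G ?c v \<le> D' v" if "v \<in> verts G" for v
      using that by force
    let ?E = "\<lambda>v. D' v - divf G ?c v"
    obtain f where f: "(\<lambda>v. D' v - D v) = divf G f" and D'0: "D' \<in> Div G"
      using D' by (auto simp: linear_system_def equivalent_def)
    have "(\<lambda>v. ?E v - D v) = divf G (\<lambda>v. f v + - ?c v)"
      using f unfolding divf_add divf_uminus by (auto simp: fun_eq_iff algebra_simps)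
    then have "equivalent G ?E D"
      unfolding equivalent_def by blast
    then have E: "?E \<in> linear_system G D"
      using le D'0 divf_outside by (auto simp: linear_system_def Div_def effective_def)
    have "energy D' - energy ?E = (\<Sum>v\<in>verts G. (h v - m) * divf G ?c v)"
      by (simp add: energy_def sum_subtractf[symmetric] algebra_simps)
    \<comment> \<open>Self-adjointness moves the Laplacian from the indicator of \<open>S\<close>
      onto \<open>h\<close>, which is strictly superharmonic on \<open>S\<close>.\<close>
    also have "\<dots> = (\<Sum>v\<in>verts G. ?c v * divf G h v)"
      unfolding green by (simp add: mult.commute)
    also have "\<dots> > 0"
    proof -
      obtain v where v: "v \<in> S" using S(2) by blast
      have "0 < divf G h w" if "w \<in> S" for w using S(1) h that by blast
      then show ?thesis
        using S v by (intro sum_pos2[OF finite_verts, of v]) (auto simp: of_bool_def less_imp_le)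
    qed
    finally show False
      using least[OF E] nonneg[OF E] by linarith
  qed
  with D' show ?thesis by blast
qed

section \<open>Dhar's burning argument\<close>

text \<open>Along an edge leaving the maximum set \<open>f\<close> drops by at least 1, by
  integrality, so firing just this set costs its vertices no more than \<open>f\<close> does.
  Vertices outside the set only receive chips.\<close>

lemma divf_max_set_le:
  assumes "effective G D" and f: "\<forall>v\<in>verts G. divf G f v \<le> D v" and v: "v \<in> verts G"
  shows "divf G (\<lambda>v. of_bool (v \<in> {u\<in>verts G. f u = Max (f ` verts G)})) v \<le> D v"
proof -
  let ?S = "{u\<in>verts G. f u = Max (f ` verts G)}"
  have le: "f w \<le> Max (f ` verts G)" if "w \<in> verts G" for w
    using finite_verts that by simp
  show ?thesis
  proof (cases "v \<in> ?S")
    case True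
    have "divf G (\<lambda>v. of_bool (v \<in> ?S)) v \<le> divf G f v"
      unfolding divf_eq_sum
    proof (rule sum_mono)
      fix e assume e: "e \<in> edges G"
      have "w \<in> ?S \<or> f w \<le> Max (f ` verts G) - 1" if "w \<in> verts G" for w
        using le[OF that] that by auto
      from this[OF source_in_verts[OF e]] this[OF target_in_verts[OF e]]
      show "of_bool (s e = v) * (of_bool (s e \<in> ?S) - of_bool (t e \<in> ?S)) +
          of_bool (t e = v) * (of_bool (t e \<in> ?S) - of_bool (s e \<in> ?S))
        \<le> of_bool (s e = v) * (f (s e) - f (t e)) + of_bool (t e = v) * (f (t e) - f (s e))"
        using True by (auto simp: of_bool_def)
    qed
    with f v show ?thesis by force
  next
    case False
    then have "divf G (\<lambda>v. of_bool (v \<in> ?S)) v \<le> 0"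
      unfolding divf_eq_sum by (intro sum_nonpos) (auto simp: of_bool_def)
    with assms(1) v show ?thesis by (force simp: effective_def)
  qed
qed

text \<open>When \<open>S\<close> fires, a vertex of \<open>S\<close> loses one chip along each edge
  leaving \<open>S\<close> and gains none; a vertex without net loss has no such edge.\<close>

lemma no_chips_imp_neighbours_fired:
  assumes le: "divf G (\<lambda>v. of_bool (v \<in> S)) v \<le> 0"
    and v: "v \<in> S" and edge: "(v, w) \<in> edge_rel G"
  shows "w \<in> S"
proof (rule ccontr)
  assume w: "w \<notin> S"
  obtain e where e: "e \<in> edges G" "s e = v \<and> t e = w \<or> s e = w \<and> t e = v"
    using edge by (auto simp: edge_rel_iff)
  have "0 < divf G (\<lambda>v. of_bool (v \<in> S)) v"
    unfolding divf_eq_sum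
    by (rule sum_pos2[OF finite_edges e(1)]) (use e w v in \<open>auto simp: of_bool_def\<close>)
  with le show False by simp
qed

text \<open>The path of chip-free vertices lets Dhar's fire spread from \<open>x\<close> to \<open>u\<close> unhindered, so that the
  \<open>x\<close>-reduced divisor \<open>D'\<close> is \<open>u\<close>-reduced as well.\<close>

lemma linear_system_empty_of_reduced:
  assumes D: "D \<in> Div G"
    and D': "D' \<in> linear_system G D"
    and reduced: "\<And>S. S \<subseteq> verts G - {x} \<Longrightarrow> S \<noteq> {} \<Longrightarrow>
           \<exists>v\<in>verts G. D' v < divf G (\<lambda>v. of_bool (v \<in> S)) v"
    and burns: "(x, u) \<in> (edge_rel G \<inter> {v. D' v = 0} \<times> {v. D' v = 0})\<^sup>*"
    and u: "u \<in> verts G" "D' u = 0"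
  shows "linear_system G (\<lambda>v. D v - of_bool (v = u)) = {}"
proof (rule ccontr)
  assume *: "linear_system G (\<lambda>v. D v - of_bool (v = u)) \<noteq> {}"
  have "(\<lambda>v. D v - of_bool (v = u)) \<in> Div G"
    using D u by (auto simp: Div_def)
  with * obtain f where f: "\<And>v. v \<in> verts G \<Longrightarrow> 0 \<le> D v - of_bool (v = u) + divf G f v"
    using linear_system_nonempty_iff by blast
  obtain g where g: "(\<lambda>v. D' v - D v) = divf G g" and D'0: "effective G D'"
    using D' by (auto simp: linear_system_def equivalent_def)
  have g: "D v = D' v - divf G g v" for v
    using fun_cong[OF g, of v] by simp
  \<comment> \<open>Firing \<open>p\<close> turns \<open>D'\<close> into
    \<open>D + divf G f\<close>, which is effective and has a chip at \<open>u\<close>.\<close>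
  define p where "p v = g v + - f v" for v
  have p: "divf G p v \<le> D' v - of_bool (v = u)" if "v \<in> verts G" for v
    using f[OF that] unfolding g p_def[abs_def] divf_add divf_uminus by simp
  let ?S = "{v\<in>verts G. p v = Max (p ` verts G)}"
  have le: "divf G (\<lambda>v. of_bool (v \<in> ?S)) v \<le> D' v" if "v \<in> verts G" for v
    by (rule divf_max_set_le[OF D'0 _ that]) (use p in \<open>force simp: of_bool_def split: if_splits\<close>)
  have "Max (p ` verts G) \<in> p ` verts G"
    using finite_verts verts_nonempty by simp
  then have "?S \<noteq> {}" by auto
  have "x \<in> ?S"
  proof (rule ccontr)
    assume "x \<notin> ?S"
    then have "\<exists>v\<in>verts G. D' v < divf G (\<lambda>v. of_bool (v \<in> ?S)) v"
      using \<open>?S \<noteq> {}\<close> by (intro reduced) auto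
    with le show False by force
  qed
  from burns this have "u \<in> ?S"
  proof (induction rule: rtrancl_induct)
    case (step y z)
    then have y: "y \<in> ?S" "D' y = 0" "(y, z) \<in> edge_rel G" by auto
    show ?case
      by (rule no_chips_imp_neighbours_fired[OF _ y(1,3)]) (use le[of y] y in auto)
  qed
  \<comment> \<open>At a maximum of \<open>p\<close> chips are only lost, so \<open>u\<close>, empty
    in \<open>D'\<close>, cannot have gained the required chip.\<close>
  have "0 \<le> divf G p u"
    unfolding divf_eq_sum
  proof (rule sum_nonneg)
    fix e assume e: "e \<in> edges G"
    have "p w \<le> p u" if "w \<in> verts G" for w
      using \<open>u \<in> ?S\<close> finite_verts that by simp
    then show "0 \<le> of_bool (s e = u) * (p (s e) - p (t e)) + of_bool (t e = u) * (p (t e) - p (s e))"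
      using source_in_verts[OF e] target_in_verts[OF e] by (auto simp: of_bool_def)
  qed
  then show False using p[OF u(1)] u(2) by simp
qed

section \<open>Rank-determining sets\<close>

text \<open>Induction on the number of chips of \<open>E\<close> outside \<open>A\<close>. Moving
  one of them from \<open>x\<close> to any \<open>v\<close> in \<open>A\<close> lowers this number,
  so the induction hypothesis supplies what \<open>det\<close> needs for \<open>D - E\<close> with
  the chip at \<open>x\<close> given back.\<close>

lemma rank_determining:
  assumes A: "A \<subseteq> verts G"
    and det: "\<And>D x. D \<in> Div G \<Longrightarrow> x \<in> verts G \<Longrightarrow>
        (\<And>v. v \<in> A \<Longrightarrow> linear_system G (\<lambda>y. D y - of_bool (y = v)) \<noteq> {}) \<Longrightarrow>
        linear_system G (\<lambda>y. D y - of_bool (y = x)) \<noteq> {}"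
    and D: "D \<in> Div G"
    and supp: "\<And>E. E \<in> Div G \<Longrightarrow> effective G E \<Longrightarrow> deg G E = d \<Longrightarrow> \<forall>v\<in>verts G - A. E v = 0 \<Longrightarrow>
        linear_system G (\<lambda>v. D v - E v) \<noteq> {}"
    and E: "E \<in> Div G" "effective G E" "deg G E = d"
  shows "linear_system G (\<lambda>v. D v - E v) \<noteq> {}"
  using E
proof (induction "nat (\<Sum>v\<in>verts G - A. E v)" arbitrary: E)
  case 0
  have nn: "0 \<le> E v" if "v \<in> verts G - A" for v
    using 0(3) that by (auto simp: effective_def)
  have "0 \<le> (\<Sum>v\<in>verts G - A. E v)"
    using nn by (rule sum_nonneg)
  with 0(1) have "(\<Sum>v\<in>verts G - A. E v) = 0" by linarith
  then have "\<forall>v\<in>verts G - A. E v = 0"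
    using sum_nonneg_eq_0_iff[of "verts G - A" E] finite_verts nn by auto
  then show ?case using supp 0 by blast
next
  case (Suc n)
  then obtain x where x: "x \<in> verts G - A" "0 < E x"
    by (metis nat_le_0 not_less old.nat.distinct(2) sum_nonpos)
  let ?E = "\<lambda>v y. E y - of_bool (y = x) + of_bool (y = v)"
  have "(\<lambda>y. D y - E y + of_bool (y = x)) \<in> Div G"
    using D Suc.prems x by (auto simp: Div_def)
  then have "linear_system G (\<lambda>y. D y - E y + of_bool (y = x) - of_bool (y = x)) \<noteq> {}"
  proof (rule det)
    fix v assume v: "v \<in> A"
    have bx: "(\<Sum>y\<in>B. of_bool (y = z)) = (of_bool (z \<in> B) :: int)" if "finite B" for B and z :: 'v
      using that by (simp add: of_bool_def)
    have "(\<Sum>y\<in>verts G - A. ?E v y) = (\<Sum>y\<in>verts G - A. E y) - 1"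
      using x v finite_verts by (simp add: sum.distrib sum_subtractf bx)
    then have "n = nat (\<Sum>y\<in>verts G - A. ?E v y)"
      using Suc.hyps(2) by simp
    moreover have "?E v \<in> Div G"
      using Suc.prems x v A by (auto simp: Div_def)
    moreover have "effective G (?E v)"
      using Suc.prems x by (auto simp: effective_def of_bool_def)
    moreover have "deg G (?E v) = d"
      using Suc.prems x v A finite_verts
      by (auto simp: deg_def sum.distrib sum_subtractf bx)
    ultimately have "linear_system G (\<lambda>y. D y - ?E v y) \<noteq> {}"
      by (rule Suc.hyps(1))
    moreover have "(\<lambda>y. D y - ?E v y) = (\<lambda>y. D y - E y + of_bool (y = x) - of_bool (y = v))"
      by auto
    ultimately show "linear_system G (\<lambda>y. D y - E y + of_bool (y = x) - of_bool (y = v)) \<noteq> {}"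
      by simp
  qed (use x in auto)
  then show ?case by simp
qed

end

section \<open>Paths and the Laplacian in the subdivision\<close>

locale subdivided_graph = oriented_graph +
  fixes k :: nat
  assumes loopless: "loopless G"
begin

abbreviation H where "H \<equiv> subdivide k s t G"

abbreviation p where "p \<equiv> path_vertex k s t"

lemma source_neq_target: "e \<in> edges G \<Longrightarrow> s e \<noteq> t e"
  using loopless ends_eq by (force simp: loopless_def)

lemma path_vertex_eq_Inl_iff:
  "p e i = Inl v \<longleftrightarrow> i = 0 \<and> s e = v \<or> i = Suc k \<and> t e = v"
  by (auto simp: path_vertex_def)

text \<open>Looplessness keeps vertices number 0 and \<open>Suc k\<close> apart.\<close>

lemma path_vertex_eq_iff:
  "e \<in> edges G \<Longrightarrow> p e i = p e j \<longleftrightarrow> i = j"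
  using source_neq_target[of e] source_neq_target[of e, THEN not_sym]
  by (auto simp: path_vertex_def split: if_splits)

lemma path_vertex_eq_inner_iff:
  "0 < j \<Longrightarrow> j \<le> k \<Longrightarrow> p e' i = p e j \<longleftrightarrow> e' = e \<and> i = j"
  by (auto simp: path_vertex_def)

lemma verts_subdivide: "verts H = Inl ` verts G \<union> Inr ` (edges G \<times> {1..k})"
  and edges_subdivide: "edges H = edges G \<times> {0..k}"
  and ends_subdivide: "ends H (e, i) = Upair (p e i) (p e (Suc i))"
  by (simp_all add: subdivide_def)

lemma path_vertex_in_verts: "e \<in> edges G \<Longrightarrow> i \<le> Suc k \<Longrightarrow> p e i \<in> verts H"
  using source_in_verts target_in_verts by (auto simp: path_vertex_def verts_subdivide)

lemma verts_subdivide_cases: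
  assumes "x \<in> verts H"
  obtains v where "v \<in> verts G" "x = Inl v"
  | e i where "e \<in> edges G" "0 < i" "i \<le> k" "x = p e i"
  using assms by (force simp: verts_subdivide path_vertex_def)

lemma path_edge:
  assumes "e \<in> edges G" "i \<le> k"
  shows "(p e i, p e (Suc i)) \<in> edge_rel H" "(p e (Suc i), p e i) \<in> edge_rel H"
  unfolding edge_rel_def
  by (intro CollectI case_prodI bexI[of _ "(e, i)"];
      use assms in \<open>simp add: edges_subdivide ends_subdivide Upair_inject\<close>)+

text \<open>With \<open>Z\<close> the chip-free vertices this carries the fire along a path; with
  \<open>Z = UNIV\<close> it gives connectedness.\<close>

lemma path_rtrancl:
  assumes e: "e \<in> edges G" and ab: "a \<le> b" "b \<le> Suc k"
    and Z: "\<And>j. a \<le> j \<Longrightarrow> j \<le> b \<Longrightarrow> p e j \<in> Z"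
  shows "(p e a, p e b) \<in> (edge_rel H \<inter> Z \<times> Z)\<^sup>* \<and> (p e b, p e a) \<in> (edge_rel H \<inter> Z \<times> Z)\<^sup>*"
  using ab Z
proof (induction b rule: dec_induct)
  case (step n)
  then have "(p e n, p e (Suc n)) \<in> edge_rel H \<inter> Z \<times> Z" "(p e (Suc n), p e n) \<in> edge_rel H \<inter> Z \<times> Z"
    using path_edge[OF e] by auto
  moreover have "(p e a, p e n) \<in> (edge_rel H \<inter> Z \<times> Z)\<^sup>* \<and> (p e n, p e a) \<in> (edge_rel H \<inter> Z \<times> Z)\<^sup>*"
    using step by simp
  ultimately show ?case
    by (meson rtrancl.rtrancl_into_rtrancl converse_rtrancl_into_rtrancl)
qed simp

lemma finite_connected_subdivide: "finite_connected H"
proof -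
  have path: "(p e a, p e b) \<in> (edge_rel H)\<^sup>* \<and> (p e b, p e a) \<in> (edge_rel H)\<^sup>*"
    if "e \<in> edges G" "a \<le> b" "b \<le> Suc k" for e a b
    using path_rtrancl[OF that, of UNIV] by simp
  have old: "(Inl u, Inl v) \<in> (edge_rel H)\<^sup>*" if "u \<in> verts G" "v \<in> verts G" for u v
    using connected[OF that]
  proof (induction rule: rtrancl_induct)
    case (step y z)
    then obtain e where "e \<in> edges G" "s e = y \<and> t e = z \<or> s e = z \<and> t e = y"
      by (auto simp: edge_rel_iff)
    then have "(Inl y, Inl z) \<in> (edge_rel H)\<^sup>*"
      using path[of e 0 "Suc k"] by (auto simp: path_vertex_def)
    with step.IH show ?case by (rule rtrancl_trans)
  qed simp
  have near: "\<exists>v\<in>verts G. (x, Inl v) \<in> (edge_rel H)\<^sup>* \<and> (Inl v, x) \<in> (edge_rel H)\<^sup>*"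
    if "x \<in> verts H" for x
    using that
  proof (cases rule: verts_subdivide_cases)
    case (2 e i)
    then show ?thesis
      using path[of e 0 i] source_in_verts[of e] by (auto simp: path_vertex_eq_Inl_iff path_vertex_def)
  qed auto
  have "(x, y) \<in> (edge_rel H)\<^sup>*" if "x \<in> verts H" "y \<in> verts H" for x y
    using near[OF that(1)] near[OF that(2)] old by (meson rtrancl_trans)
  moreover have "finite (verts H)" "finite (edges H)"
    using finite_verts finite_edges by (auto simp: verts_subdivide edges_subdivide)
  moreover have "set_uprod (ends H e) \<subseteq> verts H" if "e \<in> edges H" for e
    using that path_vertex_in_verts by (auto simp: edges_subdivide ends_subdivide)
  moreover have "verts H \<noteq> {}"
    using verts_nonempty by (auto simp: verts_subdivide)
  ultimately show ?thesis
    unfolding finite_connected_def by blast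
qed

sublocale sub: oriented_graph H "\<lambda>(e, i). p e i" "\<lambda>(e, i). p e (Suc i)"
  by standard
    (auto simp: finite_connected_subdivide orientation_def edges_subdivide ends_subdivide)

text \<open>Only the first and last edges of a path can touch an old vertex. The form matches
  \<open>divf_eq_sum\<close> term by term.\<close>

lemma divf_Inl:
  "divf H f (Inl v) = (\<Sum>e\<in>edges G. of_bool (s e = v) * (f (Inl v) - f (p e 1)) +
                                     of_bool (t e = v) * (f (Inl v) - f (p e k)))"
proof -
  have "divf H f (Inl v) = (\<Sum>e\<in>edges G. \<Sum>i\<in>{0..k}.
      of_bool (p e i = Inl v) * (f (p e i) - f (p e (Suc i))) +
      of_bool (p e (Suc i) = Inl v) * (f (p e (Suc i)) - f (p e i)))"
    unfolding sub.divf_eq_sum edges_subdivide sum.cartesian_product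
    by (intro sum.cong refl) auto
  also have "\<dots> = (\<Sum>e\<in>edges G. \<Sum>i\<in>{0..k}.
      (if i = 0 then of_bool (s e = v) * (f (Inl v) - f (p e 1)) else 0) +
      (if i = k then of_bool (t e = v) * (f (Inl v) - f (p e k)) else 0))"
    by (intro sum.cong refl arg_cong2[of _ _ _ _ "(+)"])
      (auto simp: path_vertex_eq_Inl_iff path_vertex_def)
  also have "\<dots> = (\<Sum>e\<in>edges G. of_bool (s e = v) * (f (Inl v) - f (p e 1)) +
                                of_bool (t e = v) * (f (Inl v) - f (p e k)))"
    by (simp add: sum.distrib)
  finally show ?thesis .
qed

text \<open>An inner vertex has exactly two edges, so \<open>divf\<close> is a negated second
  difference: zero for linear functions, nonnegative for concave ones.\<close>

lemma divf_inner:
  assumes e: "e \<in> edges G" and j: "j < k"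
  shows "divf H f (p e (Suc j)) = 2 * f (p e (Suc j)) - f (p e j) - f (p e (Suc (Suc j)))"
proof -
  let ?x = "p e (Suc j)"
  have x: "p e' i = ?x \<longleftrightarrow> e' = e \<and> i = Suc j" for e' i
    using j by (simp add: path_vertex_eq_inner_iff)
  have "divf H f ?x = (\<Sum>a\<in>edges H. (if a = (e, Suc j) then f ?x - f (p e (Suc (Suc j))) else 0) +
      (if a = (e, j) then f ?x - f (p e j) else 0))"
    unfolding sub.divf_eq_sum by (intro sum.cong refl) (auto simp: x)
  also have "\<dots> = (f ?x - f (p e (Suc (Suc j)))) + (f ?x - f (p e j))"
    using e j sub.finite_edges by (simp add: sum.distrib edges_subdivide)
  finally show ?thesis by simp
qed

section \<open>The old vertices determine the rank of the subdivision\<close>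

text \<open>Only the edges \<open>(e, a)\<close> and \<open>(e, b - 1)\<close> can leave the
  complement of the open segment, and they take at most one chip each, from \<open>p e a\<close> and
  \<open>p e b\<close>. Vertices of the segment only gain.\<close>

lemma divf_segment_complement_le:
  assumes e: "e \<in> edges G" and ab: "a < b" "b \<le> Suc k"
  shows "divf H (\<lambda>v. of_bool (v \<in> verts H - p e ` {a<..<b})) v \<le> of_bool (v = p e a) + of_bool (v = p e b)"
proof -
  let ?S = "verts H - p e ` {a<..<b}"
  have S: "p e' i \<in> ?S \<longleftrightarrow> \<not> (e' = e \<and> a < i \<and> i < b)" if "e' \<in> edges G" "i \<le> Suc k" for e' i
  proof -
    have "p e' i = p e j \<longleftrightarrow> e' = e \<and> i = j" if "j \<in> {a<..<b}" for j
      using that ab by (intro path_vertex_eq_inner_iff) auto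
    then have "p e' i \<in> p e ` {a<..<b} \<longleftrightarrow> e' = e \<and> a < i \<and> i < b"
      by (auto simp: image_iff)
    then show ?thesis using path_vertex_in_verts[OF that] by simp
  qed
  have "divf H (\<lambda>v. of_bool (v \<in> ?S)) v \<le>
      (\<Sum>c\<in>edges H. (if c = (e, a) then of_bool (v = p e a) else 0) +
                    (if c = (e, b - 1) then of_bool (v = p e b) else 0))"
    unfolding sub.divf_eq_sum
  proof (rule sum_mono)
    fix c assume "c \<in> edges H"
    then obtain e' i where c: "c = (e', i)" "e' \<in> edges G" "i \<le> k"
      by (auto simp: edges_subdivide)
    have "(i = a) = (\<not> a < i \<and> a < Suc i)" "(i = b - 1) = (i < b \<and> \<not> Suc i < b)"
      using ab by auto
    moreover have "i = b - 1 \<Longrightarrow> Suc i = b" using ab by simp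
    ultimately show "of_bool ((case c of (e, i) \<Rightarrow> p e i) = v) *
          (of_bool ((case c of (e, i) \<Rightarrow> p e i) \<in> ?S) - of_bool ((case c of (e, i) \<Rightarrow> p e (Suc i)) \<in> ?S)) +
        of_bool ((case c of (e, i) \<Rightarrow> p e (Suc i)) = v) *
          (of_bool ((case c of (e, i) \<Rightarrow> p e (Suc i)) \<in> ?S) - of_bool ((case c of (e, i) \<Rightarrow> p e i) \<in> ?S))
        \<le> (if c = (e, a) then of_bool (v = p e a) else 0) +
          (if c = (e, b - 1) then of_bool (v = p e b) else (0::int))"
      unfolding c(1) prod.case using S[OF c(2), of i] S[OF c(2), of "Suc i"] c(3)
      by (cases "p e' i = v"; cases "p e' (Suc i) = v") (auto simp: of_bool_def)
  qed
  also have "\<dots> = of_bool (v = p e a) + of_bool (v = p e b)"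
    using e ab sub.finite_edges by (auto simp: sum.distrib edges_subdivide)
  finally show ?thesis .
qed

lemma original_verts_determine:
  assumes D: "D \<in> Div H" and x: "x \<in> verts H"
    and old: "\<And>v. v \<in> Inl ` verts G \<Longrightarrow> linear_system H (\<lambda>y. D y - of_bool (y = v)) \<noteq> {}"
  shows "linear_system H (\<lambda>y. D y - of_bool (y = x)) \<noteq> {}"
  using x
proof (cases rule: verts_subdivide_cases)
  case (2 e i)
  have DivH: "(\<lambda>y. D y - of_bool (y = v)) \<in> Div H" if "v \<in> verts H" for v
    using D that by (auto simp: Div_def)
  \<comment> \<open>Any single old vertex suffices to make the linear system of \<open>D\<close>
    nonempty, so that a reduced representative exists.\<close>
  obtain v where v: "v \<in> verts G" using verts_nonempty by blast
  then have vH: "Inl v \<in> verts H" by (simp add: verts_subdivide)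
  obtain f where "\<forall>y\<in>verts H. 0 \<le> D y - of_bool (y = Inl v) + divf H f y"
    using sub.linear_system_nonempty_iff[OF DivH[OF vH]] old v by blast
  then have "\<forall>y\<in>verts H. 0 \<le> D y + divf H f y"
    by (force simp: of_bool_def split: if_splits)
  then have "linear_system H D \<noteq> {}"
    using sub.linear_system_nonempty_iff[OF D] by blast
  from sub.reduced_exists[OF x this] obtain D' where D': "D' \<in> linear_system H D"
    and *: "\<forall>S. S \<subseteq> verts H - {x} \<and> S \<noteq> {} \<longrightarrow>
           (\<exists>v\<in>verts H. D' v < divf H (\<lambda>v. of_bool (v \<in> S)) v)"
    by (elim bexE)
  then have reduced: "\<exists>v\<in>verts H. D' v < divf H (\<lambda>v. of_bool (v \<in> S)) v"
    if "S \<subseteq> verts H - {x}" "S \<noteq> {}" for S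
    using that by simp
  have eff: "0 \<le> D' y" if "y \<in> verts H" for y
    using D' that by (simp add: linear_system_def effective_def)
  note pv = path_vertex_in_verts[OF 2(1)]
  have "D' x \<noteq> 0"
  proof
    assume x0: "D' x = 0"
    let ?Z = "{v. D' v = 0}"
    \<comment> \<open>A fire from \<open>x\<close> that reaches an empty old vertex contradicts
      \<open>old\<close>; hence chips must block it on both sides of \<open>x\<close>.\<close>
    have no: False if "(x, u) \<in> (edge_rel H \<inter> ?Z \<times> ?Z)\<^sup>*" "u \<in> Inl ` verts G" "D' u = 0" for u
      using sub.linear_system_empty_of_reduced[OF D D' reduced that(1)] that old
      by (auto simp: verts_subdivide)
    have "\<exists>a<i. D' (p e a) \<noteq> 0"
    proof (rule ccontr)
      assume "\<not> ?thesis"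
      then have z: "D' (p e j) = 0" if "j \<le> i" for j
        using that x0 2(4) by (metis le_neq_implies_less)
      have "(p e i, p e 0) \<in> (edge_rel H \<inter> ?Z \<times> ?Z)\<^sup>*"
        using path_rtrancl[OF 2(1), of 0 i ?Z] z 2 by simp
      moreover have "p e 0 \<in> Inl ` verts G"
        using source_in_verts[OF 2(1)] by (simp add: path_vertex_def)
      ultimately show False
        using no z[of 0] 2(4) by blast
    qed
    then obtain a where a: "a < i" "D' (p e a) \<noteq> 0" by blast
    have "\<exists>b>i. b \<le> Suc k \<and> D' (p e b) \<noteq> 0"
    proof (rule ccontr)
      assume "\<not> ?thesis"
      then have z: "D' (p e j) = 0" if "i \<le> j" "j \<le> Suc k" for j
        using that x0 2(4) by (metis le_neq_implies_less)
      have "(p e i, p e (Suc k)) \<in> (edge_rel H \<inter> ?Z \<times> ?Z)\<^sup>*"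
        using path_rtrancl[OF 2(1), of i "Suc k" ?Z] z 2 by simp
      moreover have "p e (Suc k) \<in> Inl ` verts G"
        using target_in_verts[OF 2(1)] by (simp add: path_vertex_def)
      ultimately show False
        using no z[of "Suc k"] 2 by simp
    qed
    then obtain b where b: "i < b" "b \<le> Suc k" "D' (p e b) \<noteq> 0" by blast
    let ?S = "verts H - p e ` {a<..<b}"
    have ab: "a < b" "p e a \<noteq> p e b" "a \<le> Suc k"
      using a b path_vertex_eq_iff[OF 2(1), of a b] by auto
    have "p e a \<in> ?S"
      using pv[OF ab(3)] path_vertex_eq_iff[OF 2(1)] by auto
    moreover have "?S \<subseteq> verts H - {x}" using a b 2(4) by auto
    ultimately obtain y where y: "y \<in> verts H" "D' y < divf H (\<lambda>v. of_bool (v \<in> ?S)) y"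
      using reduced[of ?S] by blast
    \<comment> \<open>The vertices \<open>p e a\<close> and \<open>p e b\<close> are distinct and
      hold a chip each, so no vertex goes into debt.\<close>
    then have "D' y < of_bool (y = p e a) + of_bool (y = p e b)"
      using divf_segment_complement_le[OF 2(1) ab(1) b(2), of y] by linarith
    moreover have "1 \<le> D' (p e a)" "1 \<le> D' (p e b)"
      using a(2) b(3) eff[OF pv[OF ab(3)]] eff[OF pv[OF b(2)]] by linarith+
    ultimately show False
      using ab(2) eff[OF y(1)] by (auto simp: of_bool_def split: if_splits)
  qed
  then have "1 \<le> D' x" using eff[OF x] by simp
  then have "(\<lambda>y. D' y - of_bool (y = x)) \<in> linear_system H (\<lambda>y. D y - of_bool (y = x))"
    using D' x by (auto simp: linear_system_def Div_def effective_def equivalent_def of_bool_def)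
  then show ?thesis by blast
qed (use old in auto)

section \<open>Comparing linear systems of \<open>G\<close> and its subdivision\<close>

lemma extend_divisor_in_Div: "D \<in> Div G \<Longrightarrow> extend_divisor D \<in> Div H"
  by (auto simp: Div_def extend_divisor_def verts_subdivide split: sum.split)

lemma extend_divisor_path_vertex: "0 < i \<Longrightarrow> i \<le> k \<Longrightarrow> extend_divisor D (p e i) = 0"
  by (simp add: extend_divisor_def path_vertex_def)

lemma extend_divisor_diff:
  "extend_divisor (\<lambda>v. D v - E v) = (\<lambda>x. extend_divisor D x - extend_divisor E x)"
  by (auto simp: extend_divisor_def split: sum.split)

lemma effective_extend_divisor: "effective H (extend_divisor D) \<longleftrightarrow> effective G D"
  by (simp add: effective_def extend_divisor_def verts_subdivide ball_Un)

lemma deg_extend_divisor: "deg H (extend_divisor D) = deg G D"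
proof -
  have "(\<Sum>x\<in>verts H. f x) = (\<Sum>x\<in>Inl ` verts G. f x)" if "\<And>y. f (Inr y) = 0" for f :: "_ \<Rightarrow> int"
    by (rule sum.mono_neutral_right[OF sub.finite_verts]) (use that in \<open>auto simp: verts_subdivide\<close>)
  from this[of "extend_divisor D"] show ?thesis
    by (simp add: deg_def sum.reindex extend_divisor_def)
qed

lemma linear_system_subdivide_nonempty:
  assumes D: "D \<in> Div G" and nonempty: "linear_system G D \<noteq> {}"
  shows "linear_system H (extend_divisor D) \<noteq> {}"
proof -
  obtain f where f: "\<And>v. v \<in> verts G \<Longrightarrow> 0 \<le> D v + divf G f v"
    using nonempty linear_system_nonempty_iff[OF D] by blast
  \<comment> \<open>Linear interpolation of \<open>f\<close>, scaled by \<open>k + 1\<close> to stay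
    integral. Each step along \<open>e\<close> changes \<open>g\<close> by
    \<open>f (t e) - f (s e)\<close>, so \<open>divf\<close> is unchanged at old vertices and zero
    at inner ones.\<close>
  define g where "g = case_sum (\<lambda>v. (int k + 1) * f v)
      (\<lambda>(e, i). (int k + 1 - int i) * f (s e) + int i * f (t e))"
  have g: "g (p e i) = (int k + 1 - int i) * f (s e) + int i * f (t e)" for e i
    by (auto simp: g_def path_vertex_def algebra_simps)
  have gI: "g (Inl v) = (int k + 1) * f v" for v
    by (simp add: g_def)
  have "0 \<le> extend_divisor D x + divf H g x" if "x \<in> verts H" for x
    using that
  proof (cases rule: verts_subdivide_cases)
    case (1 v)
    have "divf H g (Inl v) = divf G f v"
      unfolding divf_Inl divf_eq_sum
      by (intro sum.cong refl) (auto simp: g gI algebra_simps)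
    then show ?thesis using 1 f by (simp add: extend_divisor_def)
  next
    case (2 e i)
    then obtain j where j: "i = Suc j" "j < k" by (cases i) auto
    have "divf H g (p e (Suc j)) = 0"
      unfolding divf_inner[OF 2(1) j(2)] g by (simp add: algebra_simps)
    then show ?thesis using 2 j extend_divisor_path_vertex by simp
  qed
  then show ?thesis
    using sub.linear_system_nonempty_iff[OF extend_divisor_in_Div[OF D]] by blast
qed

text \<open>A function on the subdivision whose divisor is nonnegative on the inner vertices is concave
  along each path, so its slope at an end is at least the average slope; rounding its values divided
  by \<open>k + 1\<close> down can only increase the coefficients at the old vertices.\<close>

lemma linear_system_nonempty_of_subdivide:
  assumes D: "D \<in> Div G" and nonempty: "linear_system H (extend_divisor D) \<noteq> {}"
  shows "linear_system G D \<noteq> {}"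
proof -
  obtain f where f: "\<And>x. x \<in> verts H \<Longrightarrow> 0 \<le> extend_divisor D x + divf H f x"
    using nonempty sub.linear_system_nonempty_iff[OF extend_divisor_in_Div[OF D]] by blast
  define n where "n = int k + 1"
  define g where "g v = f (Inl v) div n" for v
  have n: "0 < n" by (simp add: n_def)
  \<comment> \<open>Adding a multiple of \<open>n\<close> commutes with rounding down, so an integer
    bound on the average slope survives the division.\<close>
  have floor: "a \<le> x div n - y div n" if "n * a \<le> x - y" for a x y
  proof -
    have "(n * a + y) div n \<le> x div n"
      using that n by (intro zdiv_mono1) auto
    then show ?thesis using n by simp
  qed
  have concave: "n * (f (p e 0) - f (p e 1)) \<le> f (p e 0) - f (p e (Suc k))"
    "n * (f (p e (Suc k)) - f (p e k)) \<le> f (p e (Suc k)) - f (p e 0)" if e: "e \<in> edges G" for e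
  proof -
    let ?c = "\<lambda>i. f (p e (Suc i)) - f (p e i)"
    have slope_step: "?c (Suc j) \<le> ?c j" if "j < k" for j
    proof -
      have "0 \<le> extend_divisor D (p e (Suc j)) + divf H f (p e (Suc j))"
        using that e by (intro f path_vertex_in_verts) auto
      then show ?thesis
        using that by (simp add: divf_inner[OF e that] extend_divisor_path_vertex)
    qed
    have anti: "?c j \<le> ?c i" if "i \<le> j" "j \<le> k" for i j
      using that
    proof (induction j rule: dec_induct)
      case (step m)
      then show ?case using slope_step[of m] by linarith
    qed simp
    have tele: "(\<Sum>i\<le>k. ?c i) = f (p e (Suc k)) - f (p e 0)"
      unfolding lessThan_Suc_atMost[symmetric] by (rule sum_lessThan_telescope)
    \<comment> \<open>The \<open>k + 1\<close> slopes decrease weakly, so their sum lies between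
      \<open>k + 1\<close> times the last and \<open>k + 1\<close> times the first.\<close>
    have "(\<Sum>i\<le>k. ?c i) \<le> (\<Sum>i\<le>k. ?c 0)" "(\<Sum>i\<le>k. ?c k) \<le> (\<Sum>i\<le>k. ?c i)"
      by (intro sum_mono anti; simp)+
    then show "n * (f (p e 0) - f (p e 1)) \<le> f (p e 0) - f (p e (Suc k))"
      "n * (f (p e (Suc k)) - f (p e k)) \<le> f (p e (Suc k)) - f (p e 0)"
      unfolding tele by (simp_all add: n_def algebra_simps)
  qed
  have "0 \<le> D v + divf G g v" if v: "v \<in> verts G" for v
  proof -
    have "divf H f (Inl v) \<le> divf G g v"
      unfolding divf_Inl divf_eq_sum
    proof (rule sum_mono)
      fix e assume e: "e \<in> edges G"
      note c = concave[OF e, THEN floor]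
      show "of_bool (s e = v) * (f (Inl v) - f (p e 1)) + of_bool (t e = v) * (f (Inl v) - f (p e k))
          \<le> of_bool (s e = v) * (g (s e) - g (t e)) + of_bool (t e = v) * (g (t e) - g (s e))"
        using c source_neq_target[OF e]
        by (auto simp: g_def path_vertex_def[of _ _ _ _ 0] path_vertex_def[of _ _ _ _ "Suc k"])
    qed
    moreover have "0 \<le> D v + divf H f (Inl v)"
      using f[of "Inl v"] v by (simp add: extend_divisor_def verts_subdivide)
    ultimately show ?thesis by linarith
  qed
  then show ?thesis
    using linear_system_nonempty_iff[OF D] by blast
qed

section \<open>Equality of the ranks\<close>

text \<open>A least-degree \<open>M\<close> with empty linear system for \<open>D - M\<close> on
  \<open>G\<close> stays such a divisor when extended to \<open>H\<close>. No \<open>E\<close> on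
  \<open>H\<close> of smaller degree competes, since \<open>rank_determining\<close> reduces to
  divisors supported on old vertices, which come from \<open>G\<close>.\<close>

lemma rank_subdivide:
  assumes D: "D \<in> Div G"
  shows "rank H (extend_divisor D) = rank G D"
proof -
  let ?P = "\<lambda>E. E \<in> Div G \<and> effective G E \<and> linear_system G (\<lambda>v. D v - E v) = {}"
  obtain v where v: "v \<in> verts G" using verts_nonempty by blast
  \<comment> \<open>Subtracting more than \<open>deg G D\<close> chips leaves negative degree, hence
    an empty linear system, so the minimum is over a nonempty set. The \<open>max 0\<close> keeps
    \<open>E0\<close> effective when \<open>deg G D\<close> is negative.\<close>
  define E0 where "E0 y = (if y = v then max 0 (deg G D + 1) else 0)" for y
  have "deg G D < deg G E0"
    using v finite_verts by (simp add: deg_def E0_def)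
  then have "linear_system G (\<lambda>v. D v - E0 v) = {}"
    using deg_nonneg deg_linear_system[of _ "\<lambda>v. D v - E0 v"]
    by (force simp: linear_system_def deg_def sum_subtractf)
  then have "?P E0"
    using v by (auto simp: E0_def Div_def effective_def)
  then obtain M where M: "?P M" and least: "\<And>E. ?P E \<Longrightarrow> nat (deg G M) \<le> nat (deg G E)"
    using ex_has_least_nat[of ?P E0 "\<lambda>E. nat (deg G E)"] by blast
  have G: "(LEAST d. d \<in> {deg G E | E. ?P E}) = deg G M"
    using M least deg_nonneg by (intro Least_equality) (auto, force)
  have H: "(LEAST d. d \<in> {deg H E | E. E \<in> Div H \<and> effective H E \<and>
      linear_system H (\<lambda>v. extend_divisor D v - E v) = {}}) = deg G M"
  proof (rule Least_equality)
    have "(\<lambda>v. D v - M v) \<in> Div G" using D M by (simp add: Div_def)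
    from linear_system_nonempty_of_subdivide[OF this]
    have "linear_system H (\<lambda>v. extend_divisor D v - extend_divisor M v) = {}"
      using M unfolding extend_divisor_diff by blast
    then show "deg G M \<in> {deg H E | E. E \<in> Div H \<and> effective H E \<and>
        linear_system H (\<lambda>v. extend_divisor D v - E v) = {}}"
      using M extend_divisor_in_Div effective_extend_divisor
      by (intro CollectI exI[of _ "extend_divisor M"]) (simp add: deg_extend_divisor)
  next
    fix d assume "d \<in> {deg H E | E. E \<in> Div H \<and> effective H E \<and>
        linear_system H (\<lambda>v. extend_divisor D v - E v) = {}}"
    then obtain E where E: "E \<in> Div H" "effective H E" "deg H E = d"
      and empty: "linear_system H (\<lambda>v. extend_divisor D v - E v) = {}"
      by blast
    show "deg G M \<le> d"
    proof (rule ccontr)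
      assume d: "\<not> deg G M \<le> d"
      have "linear_system H (\<lambda>v. extend_divisor D v - E v) \<noteq> {}"
      proof (rule sub.rank_determining[OF _ original_verts_determine extend_divisor_in_Div[OF D] _ E])
        fix F assume F: "F \<in> Div H" "effective H F" "deg H F = d" "\<forall>v\<in>verts H - Inl ` verts G. F v = 0"
        define F' where "F' v = F (Inl v)" for v
        have "F x = 0" if "x = Inr y" for x y
          using F(1,4) that by (cases "x \<in> verts H") (auto simp: Div_def)
        then have FF: "F = extend_divisor F'"
          by (auto simp: extend_divisor_def F'_def split: sum.split)
        have F': "F' \<in> Div G" "effective G F'" "deg G F' = d"
          using F FF effective_extend_divisor deg_extend_divisor
          by (auto simp: Div_def F'_def verts_subdivide)
        then have "linear_system G (\<lambda>v. D v - F' v) \<noteq> {}"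
          using least[of F'] d deg_nonneg[of F'] by auto
        moreover have "(\<lambda>v. D v - F' v) \<in> Div G" using D F' by (simp add: Div_def)
        ultimately show "linear_system H (\<lambda>v. extend_divisor D v - F v) \<noteq> {}"
          unfolding FF extend_divisor_diff[symmetric] by (intro linear_system_subdivide_nonempty)
      qed (auto simp: verts_subdivide)
      with empty show False by simp
    qed
  qed
  show ?thesis
    unfolding rank_def G H ..
qed

end

theorem corollary3p4:
  fixes G :: "('v, 'e) multigraph"
    and D :: "'v \<Rightarrow> int"
    and s t :: "'e \<Rightarrow> 'v"
    and k :: nat
  assumes "finite_connected G"
    and "loopless G"
    and "D \<in> Div G"
    and "orientation G s t"
    and "k > 0"
  shows "rank G D = rank (subdivide k s t G) (extend_divisor D)"
proof -
  interpret subdivided_graph G s t k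
    using assms by unfold_locales
  show ?thesis
    using rank_subdivide[OF assms(3)] by simp
qed

end
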